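(* Consider the nonlinear autoregressive model $Y_{1t}^N=\rho(Y_{1,t-1}^N,\dots,Y_{1,t-K}^N)+u_t$ with $\rho$ a (nonlinear) function, and let $\hat\rho$ be an estimator of $\rho$. Let $P_t^N=\rho(Y_{1,t-1}^N,\dots,Y_{1,t-K}^N)$ and $\hat P_t^N=\hat\rho(Y_{1,t-1}^N,\dots,Y_{1,t-K}^N)$. Suppose that $\|\hat\rho-\rho\|=O_P(r_T)$ with $r_T=o(1)$ for some norm $\|\cdot\|$, and that $$\max_{K+1\le t\le T}\big|\hat\rho(Y_{1,t-1}^N,\dots,Y_{1,t-K}^N)-\rho(Y_{1,t-1}^N,\dots,Y_{1,t-K}^N)\big|\le\ell_T\|\hat\rho-\rho\|$$ for some $\ell_T$ with $\ell_Tr_T=o(1)$. Then, for any $T_0+1\le t\le T$, $$\hat P_t^N-P_t^N=o_P(1)\quad\text{and}\quad\frac1T\sum_{t=K+1}^T(\hat P_t^N-P_t^N)^2=o_P(1).$$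
   Context: $T=T_0+T_*$, $K$ is the fixed number of lags, and asymptotics are as $T_0\to\infty$. *)

theory Defs
  imports "HOL-Probability.Probability" "HOL-Library.Landau_Symbols"
begin

text \<open>Stochastic order symbols.  Measurability is required eventually, since the measure of a
  non-measurable set is \<open>0\<close> by convention and would make the probability bounds void.\<close>

definition bigo_P :: "'a measure \<Rightarrow> (nat \<Rightarrow> 'a \<Rightarrow> real) \<Rightarrow> (nat \<Rightarrow> real) \<Rightarrow> bool" where
  "bigo_P M X a \<longleftrightarrow>
     (\<forall>\<^sub>F n in sequentially. X n \<in> borel_measurable M) \<and>
     (\<forall>\<epsilon>>0. \<exists>C>0. \<forall>\<^sub>F n in sequentially. measure M {\<omega> \<in> space M. \<bar>X n \<omega>\<bar> > C * \<bar>a n\<bar>} \<le> \<epsilon>)"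

definition smallo_P :: "'a measure \<Rightarrow> (nat \<Rightarrow> 'a \<Rightarrow> real) \<Rightarrow> (nat \<Rightarrow> real) \<Rightarrow> bool" where
  "smallo_P M X a \<longleftrightarrow>
     (\<forall>\<^sub>F n in sequentially. X n \<in> borel_measurable M) \<and>
     (\<forall>\<epsilon>>0. (\<lambda>n. measure M {\<omega> \<in> space M. \<bar>X n \<omega>\<bar> > \<epsilon> * \<bar>a n\<bar>}) \<longlonglongrightarrow> 0)"

text \<open>\<open>\<real>\<^sup>K\<close> is represented by the extensional functions on \<open>{1..K}\<close>; coordinate \<open>k\<close> of the regressor
  is the \<open>k\<close>-th lag.  The subtraction does not truncate for \<open>t \<ge> K + 1\<close>.\<close>

definition lag_space :: "nat \<Rightarrow> (nat \<Rightarrow> real) set" where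
  "lag_space K = {1..K} \<rightarrow>\<^sub>E UNIV"

definition lags :: "nat \<Rightarrow> (nat \<Rightarrow> 'a \<Rightarrow> real) \<Rightarrow> nat \<Rightarrow> 'a \<Rightarrow> nat \<Rightarrow> real" where
  "lags K Y t \<omega> = (\<lambda>k\<in>{1..K}. Y (t - k) \<omega>)"

text \<open>\<open>N\<close> is a norm on the linear space \<open>V\<close> of real functions with domain \<open>D\<close>.  Functions in HOL are
  total, so those agreeing on \<open>D\<close> are identified by stating definiteness on \<open>D\<close>; by the triangle
  inequality \<open>N\<close> then does not depend on values outside \<open>D\<close>.\<close>

definition function_norm :: "'x set \<Rightarrow> ('x \<Rightarrow> real) set \<Rightarrow> (('x \<Rightarrow> real) \<Rightarrow> real) \<Rightarrow> bool" where
  "function_norm D V N \<longleftrightarrow>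
     (\<lambda>x. 0) \<in> V \<and>
     (\<forall>f\<in>V. \<forall>g\<in>V. (\<lambda>x. f x + g x) \<in> V) \<and>
     (\<forall>c. \<forall>f\<in>V. (\<lambda>x. c * f x) \<in> V) \<and>
     (\<forall>f\<in>V. 0 \<le> N f) \<and>
     (\<forall>f\<in>V. N f = 0 \<longleftrightarrow> (\<forall>x\<in>D. f x = 0)) \<and>
     (\<forall>c. \<forall>f\<in>V. N (\<lambda>x. c * f x) = \<bar>c\<bar> * N f) \<and>
     (\<forall>f\<in>V. \<forall>g\<in>V. N (\<lambda>x. f x + g x) \<le> N f + N g)"

end

theory Submission
  imports Defs
begin

text \<open>One random variable controls everything: \<open>Z\<close>, which is \<open>ell\<close>
  times the norm of the estimation error \<open>rho_hat - rho\<close>. The norm is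
  \<open>O_P(r)\<close> and \<open>ell * r\<close> tends to 0, so \<open>Z\<close> is
  \<open>o_P(1)\<close> (\<open>smallo_P_scale_bigo_P\<close>). By the maximal inequality, almost
  surely \<open>Z\<close> bounds the prediction errors at all times \<open>K+1..T\<close>
  simultaneously. Hence the error at any admissible time is dominated by \<open>Z\<close>, and the
  average squared error by the square of \<open>Z\<close>, because a mean of squares is at most the
  largest square (\<open>mean_power2_le\<close>). That square is again \<open>o_P(1)\<close>
  (\<open>smallo_P_power2\<close>), and almost sure domination transfers \<open>o_P\<close> to both
  quantities (\<open>smallo_P_AE_dominated\<close>). No dependence structure of the process enters;
  the model equation serves to make \<open>P\<close> measurable.\<close>

lemma smallo_P_I:
  assumes "\<forall>\<^sub>F n in sequentially. X n \<in> borel_measurable M"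
    and "\<And>\<epsilon> \<delta>. \<epsilon> > 0 \<Longrightarrow> \<delta> > 0 \<Longrightarrow>
      \<forall>\<^sub>F n in sequentially. measure M {\<omega> \<in> space M. \<bar>X n \<omega>\<bar> > \<epsilon> * \<bar>a n\<bar>} \<le> \<delta>"
  shows "smallo_P M X a"
  unfolding smallo_P_def
proof (intro conjI allI impI assms(1))
  fix \<epsilon> :: real assume \<epsilon>: "\<epsilon> > 0"
  show "(\<lambda>n. measure M {\<omega> \<in> space M. \<bar>X n \<omega>\<bar> > \<epsilon> * \<bar>a n\<bar>}) \<longlonglongrightarrow> 0"
  proof (rule tendstoI)
    fix \<delta> :: real assume "\<delta> > 0"
    then show "\<forall>\<^sub>F n in sequentially.
        dist (measure M {\<omega> \<in> space M. \<bar>X n \<omega>\<bar> > \<epsilon> * \<bar>a n\<bar>}) 0 < \<delta>"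
      \<comment> \<open>Halving turns the non-strict bound of the assumption into the strict one
        that convergence asks for.\<close>
      using assms(2)[OF \<epsilon>, of "\<delta> / 2"] by (auto elim!: eventually_mono)
  qed
qed

lemma smallo_P_D:
  assumes "smallo_P M X a" "\<epsilon> > 0" "\<delta> > 0"
  shows "\<forall>\<^sub>F n in sequentially. measure M {\<omega> \<in> space M. \<bar>X n \<omega>\<bar> > \<epsilon> * \<bar>a n\<bar>} \<le> \<delta>"
proof -
  have "(\<lambda>n. measure M {\<omega> \<in> space M. \<bar>X n \<omega>\<bar> > \<epsilon> * \<bar>a n\<bar>}) \<longlonglongrightarrow> 0"
    using assms(1,2) by (simp add: smallo_P_def)
  from order_tendstoD(2)[OF this assms(3)] show ?thesis
    by (rule eventually_mono) simp
qed

text \<open>Up to a null set, \<open>X\<close> exceeds a threshold only where \<open>Z\<close> does.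
  Monotonicity of the measure needs the larger event to be measurable, which the definition of
  \<open>smallo_P\<close> supplies for \<open>Z\<close>; measurability of \<open>X\<close> does not
  follow from domination and is assumed separately.\<close>

lemma smallo_P_AE_dominated:
  assumes "finite_measure M"
    and X: "\<forall>\<^sub>F n in sequentially. X n \<in> borel_measurable M"
    and Z: "smallo_P M Z a"
    and le: "\<forall>\<^sub>F n in sequentially. AE \<omega> in M. \<bar>X n \<omega>\<bar> \<le> \<bar>Z n \<omega>\<bar>"
  shows "smallo_P M X a"
proof (rule smallo_P_I[OF X])
  interpret finite_measure M by fact
  fix \<epsilon> \<delta> :: real assume "\<epsilon> > 0" "\<delta> > 0"
  from smallo_P_D[OF Z this] have "\<forall>\<^sub>F n in sequentially.
      measure M {\<omega> \<in> space M. \<bar>Z n \<omega>\<bar> > \<epsilon> * \<bar>a n\<bar>} \<le> \<delta>" .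
  moreover have "\<forall>\<^sub>F n in sequentially. Z n \<in> borel_measurable M"
    using Z by (simp add: smallo_P_def)
  ultimately show "\<forall>\<^sub>F n in sequentially.
      measure M {\<omega> \<in> space M. \<bar>X n \<omega>\<bar> > \<epsilon> * \<bar>a n\<bar>} \<le> \<delta>"
    using le
  proof eventually_elim
    case (elim n)
    note [measurable] = elim(2)
    have "measure M {\<omega> \<in> space M. \<bar>X n \<omega>\<bar> > \<epsilon> * \<bar>a n\<bar>}
        \<le> measure M {\<omega> \<in> space M. \<bar>Z n \<omega>\<bar> > \<epsilon> * \<bar>a n\<bar>}"
      using elim(3) by (intro finite_measure_mono_AE) auto
    with elim(1) show ?case by simp
  qed
qed

text \<open>The square exceeds the level \<epsilon> exactly when the variable exceeds
  \<open>sqrt \<epsilon>\<close>, so the two exceedance events coincide.\<close>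

lemma smallo_P_power2:
  assumes "smallo_P M X a"
  shows "smallo_P M (\<lambda>n \<omega>. (X n \<omega>)\<^sup>2) (\<lambda>n. (a n)\<^sup>2)"
proof (rule smallo_P_I)
  show "\<forall>\<^sub>F n in sequentially. (\<lambda>\<omega>. (X n \<omega>)\<^sup>2) \<in> borel_measurable M"
    using assms by (auto simp: smallo_P_def elim!: eventually_mono)
next
  fix \<epsilon> \<delta> :: real assume \<epsilon>: "\<epsilon> > 0" and \<delta>: "\<delta> > 0"
  have "\<epsilon> * \<bar>(a n)\<^sup>2\<bar> < \<bar>x\<^sup>2\<bar> \<longleftrightarrow> sqrt \<epsilon> * \<bar>a n\<bar> < \<bar>x\<bar>" for n x
  proof -
    have "\<epsilon> * \<bar>(a n)\<^sup>2\<bar> = \<bar>sqrt \<epsilon> * a n\<bar>\<^sup>2"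
      using \<epsilon> by (simp add: power_mult_distrib)
    also have "\<dots> < \<bar>x\<^sup>2\<bar> \<longleftrightarrow> \<bar>sqrt \<epsilon> * a n\<bar> < \<bar>x\<bar>"
      by (simp add: abs_le_square_iff flip: not_le)
    finally show ?thesis
      using \<epsilon> by (simp add: abs_mult)
  qed
  then show "\<forall>\<^sub>F n in sequentially.
      measure M {\<omega> \<in> space M. \<bar>(X n \<omega>)\<^sup>2\<bar> > \<epsilon> * \<bar>(a n)\<^sup>2\<bar>} \<le> \<delta>"
    using smallo_P_D[OF assms, of "sqrt \<epsilon>"] \<epsilon> \<delta> by simp
qed

text \<open>Off an event of probability at most \<delta>, \<open>Z\<close> is at most
  \<open>C * \<bar>r n\<bar>\<close>, so the product is at most
  \<open>C * \<bar>c n * r n\<bar>\<close>. As \<open>C\<close> depends on \<delta> but not on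
  \<open>n\<close>, the little-o condition absorbs it.\<close>

lemma smallo_P_scale_bigo_P:
  assumes "finite_measure M" and Z: "bigo_P M Z r" and c: "(\<lambda>n. c n * r n) \<in> o(a)"
  shows "smallo_P M (\<lambda>n \<omega>. c n * Z n \<omega>) a"
proof (rule smallo_P_I)
  show "\<forall>\<^sub>F n in sequentially. (\<lambda>\<omega>. c n * Z n \<omega>) \<in> borel_measurable M"
    using Z by (auto simp: bigo_P_def elim!: eventually_mono)
next
  interpret finite_measure M by fact
  fix \<epsilon> \<delta> :: real assume \<epsilon>: "\<epsilon> > 0" and "\<delta> > 0"
  with Z obtain C where C: "C > 0" and
    bd: "\<forall>\<^sub>F n in sequentially. measure M {\<omega> \<in> space M. \<bar>Z n \<omega>\<bar> > C * \<bar>r n\<bar>} \<le> \<delta>"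
    unfolding bigo_P_def by blast
  \<comment> \<open>The factor \<epsilon>\<open>/C\<close> is chosen to cancel the constant
    \<open>C\<close> below.\<close>
  have "\<forall>\<^sub>F n in sequentially. norm (c n * r n) \<le> \<epsilon> / C * norm (a n)"
    using landau_o.smallD[OF c, of "\<epsilon> / C"] \<epsilon> C by simp
  moreover have "\<forall>\<^sub>F n in sequentially. Z n \<in> borel_measurable M"
    using Z by (simp add: bigo_P_def)
  ultimately show "\<forall>\<^sub>F n in sequentially.
      measure M {\<omega> \<in> space M. \<bar>c n * Z n \<omega>\<bar> > \<epsilon> * \<bar>a n\<bar>} \<le> \<delta>"
    using bd
  proof eventually_elim
    case (elim n)
    note [measurable] = elim(2)
    have "\<bar>c n * z\<bar> \<le> \<epsilon> * \<bar>a n\<bar>" if "\<bar>z\<bar> \<le> C * \<bar>r n\<bar>" for z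
    proof -
      have "\<bar>c n * z\<bar> \<le> \<bar>c n\<bar> * (C * \<bar>r n\<bar>)"
        using that by (simp add: abs_mult mult_left_mono)
      also have "\<dots> = C * \<bar>c n * r n\<bar>"
        by (simp add: abs_mult)
      also have "\<dots> \<le> C * (\<epsilon> / C * \<bar>a n\<bar>)"
        using elim(1) C by (intro mult_left_mono) auto
      finally show ?thesis using C by simp
    qed
    then have "{\<omega> \<in> space M. \<bar>c n * Z n \<omega>\<bar> > \<epsilon> * \<bar>a n\<bar>} \<subseteq> {\<omega> \<in> space M. \<bar>Z n \<omega>\<bar> > C * \<bar>r n\<bar>}"
      by (auto simp flip: not_le)
    then have "measure M {\<omega> \<in> space M. \<bar>c n * Z n \<omega>\<bar> > \<epsilon> * \<bar>a n\<bar>}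
        \<le> measure M {\<omega> \<in> space M. \<bar>Z n \<omega>\<bar> > C * \<bar>r n\<bar>}"
      by (intro finite_measure_mono) auto
    with elim(3) show ?case by simp
  qed
qed

text \<open>There are at most \<open>n\<close> summands, each at most the square of
  \<open>B\<close>, so dividing by \<open>n\<close> rather than by the number of summands only
  helps.\<close>

lemma mean_power2_le:
  fixes f :: "nat \<Rightarrow> real"
  assumes "\<And>t. t \<in> {K+1..n} \<Longrightarrow> \<bar>f t\<bar> \<le> \<bar>B\<bar>"
  shows "(1 / real n) * (\<Sum>t=K+1..n. (f t)\<^sup>2) \<le> B\<^sup>2"
proof -
  have "(\<Sum>t=K+1..n. (f t)\<^sup>2) \<le> real (card {K+1..n}) * B\<^sup>2"
    using assms by (intro sum_bounded_above) (simp add: abs_le_square_iff)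
  also have "\<dots> \<le> real n * B\<^sup>2"
    by (intro mult_right_mono) auto
  \<comment> \<open>For \<open>n = 0\<close> the left side is 0, both because the sum is empty and
    because \<open>1 / 0 = 0\<close>.\<close>
  finally show ?thesis
    by (cases "n = 0") (simp_all add: field_simps)
qed

theorem lemma6:
  fixes M :: "'a measure"
    and K :: nat and Tstar T :: "nat \<Rightarrow> nat"
    and Y u :: "nat \<Rightarrow> 'a \<Rightarrow> real"
    and rho :: "(nat \<Rightarrow> real) \<Rightarrow> real"
    and rho_hat :: "nat \<Rightarrow> 'a \<Rightarrow> (nat \<Rightarrow> real) \<Rightarrow> real"
    and P :: "nat \<Rightarrow> 'a \<Rightarrow> real"
    and P_hat :: "nat \<Rightarrow> nat \<Rightarrow> 'a \<Rightarrow> real"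
    and V :: "((nat \<Rightarrow> real) \<Rightarrow> real) set" and N :: "((nat \<Rightarrow> real) \<Rightarrow> real) \<Rightarrow> real"
    and r ell :: "nat \<Rightarrow> real"
  assumes prob: "prob_space M"
    and T: "\<And>T0. T T0 = T0 + Tstar T0"
    and Y_rv: "\<And>t. Y t \<in> borel_measurable M"
    and u_rv: "\<And>t. u t \<in> borel_measurable M"
    and model: "\<And>t \<omega>. t \<ge> K + 1 \<Longrightarrow> \<omega> \<in> space M \<Longrightarrow> Y t \<omega> = rho (lags K Y t \<omega>) + u t \<omega>"
    and P: "\<And>t \<omega>. P t \<omega> = rho (lags K Y t \<omega>)"
    and P_hat: "\<And>T0 t \<omega>. P_hat T0 t \<omega> = rho_hat T0 \<omega> (lags K Y t \<omega>)"
    and P_hat_rv: "\<And>T0 t. t \<in> {K+1..T T0} \<Longrightarrow> P_hat T0 t \<in> borel_measurable M"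
    and norm: "function_norm (lag_space K) V N"
    and in_V: "\<And>T0 \<omega>. \<omega> \<in> space M \<Longrightarrow> (\<lambda>x. rho_hat T0 \<omega> x - rho x) \<in> V"
    and rate: "bigo_P M (\<lambda>T0 \<omega>. N (\<lambda>x. rho_hat T0 \<omega> x - rho x)) r"
    and r: "r \<in> o(\<lambda>_. 1)"
    and max_le: "\<And>T0. K + 1 \<le> T T0 \<Longrightarrow> AE \<omega> in M.
        (MAX t\<in>{K+1..T T0}. \<bar>rho_hat T0 \<omega> (lags K Y t \<omega>) - rho (lags K Y t \<omega>)\<bar>)
          \<le> ell T0 * N (\<lambda>x. rho_hat T0 \<omega> x - rho x)"
    and ell: "(\<lambda>T0. ell T0 * r T0) \<in> o(\<lambda>_. 1)"
  shows "(\<forall>t. (\<forall>\<^sub>F T0 in sequentially. T0 + 1 \<le> t T0 \<and> t T0 \<le> T T0) \<longrightarrow>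
            smallo_P M (\<lambda>T0 \<omega>. P_hat T0 (t T0) \<omega> - P (t T0) \<omega>) (\<lambda>_. 1)) \<and>
         smallo_P M (\<lambda>T0 \<omega>. (1 / real (T T0)) * (\<Sum>t=K+1..T T0. (P_hat T0 t \<omega> - P t \<omega>)\<^sup>2)) (\<lambda>_. 1)"
proof -
  interpret prob_space M by fact
  define Z where "Z = (\<lambda>T0 \<omega>. ell T0 * N (\<lambda>x. rho_hat T0 \<omega> x - rho x))"
  have Z: "smallo_P M Z (\<lambda>_. 1)"
    unfolding Z_def using rate ell by (intro smallo_P_scale_bigo_P) unfold_locales
  \<comment> \<open>Nothing is assumed about measurability of \<open>rho\<close>; instead the model
    equation exhibits \<open>P t\<close> as the difference of the random variables
    \<open>Y t\<close> and \<open>u t\<close>.\<close>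
  have P_rv: "P t \<in> borel_measurable M" if "t \<ge> K + 1" for t
  proof -
    have "(\<lambda>\<omega>. Y t \<omega> - u t \<omega>) \<in> borel_measurable M"
      using Y_rv u_rv by measurable
    also have "?this \<longleftrightarrow> P t \<in> borel_measurable M"
      using model[OF that] by (intro measurable_cong) (simp add: P)
    finally show ?thesis .
  qed
  have diff_rv: "(\<lambda>\<omega>. P_hat T0 t \<omega> - P t \<omega>) \<in> borel_measurable M"
    if "t \<in> {K+1..T T0}" for T0 t
    using P_hat_rv[OF that] P_rv that by (intro borel_measurable_diff) auto
  \<comment> \<open>The quantifier over \<open>t\<close> stands inside \<open>AE\<close>, so one
    null set serves all times and the bound can be summed. If the time range is empty the claim is
    vacuous and no maximum over an empty set arises.\<close>
  have bound: "AE \<omega> in M. \<forall>t\<in>{K+1..T T0}. \<bar>P_hat T0 t \<omega> - P t \<omega>\<bar> \<le> \<bar>Z T0 \<omega>\<bar>" for T0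
  proof (cases "K + 1 \<le> T T0")
    case True
    from max_le[OF this] show ?thesis
    proof (rule AE_mp, intro AE_I2 impI ballI)
      fix \<omega> t assume max: "(MAX t\<in>{K+1..T T0}. \<bar>rho_hat T0 \<omega> (lags K Y t \<omega>) - rho (lags K Y t \<omega>)\<bar>)
          \<le> ell T0 * N (\<lambda>x. rho_hat T0 \<omega> x - rho x)" and t: "t \<in> {K+1..T T0}"
      have "\<bar>P_hat T0 t \<omega> - P t \<omega>\<bar>
          \<le> (MAX t\<in>{K+1..T T0}. \<bar>rho_hat T0 \<omega> (lags K Y t \<omega>) - rho (lags K Y t \<omega>)\<bar>)"
        using t unfolding P P_hat by (intro Max_ge) auto
      with max show "\<bar>P_hat T0 t \<omega> - P t \<omega>\<bar> \<le> \<bar>Z T0 \<omega>\<bar>"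
        by (simp add: Z_def)
    qed
  qed simp
  show ?thesis
  proof (intro conjI allI impI)
    fix t assume "\<forall>\<^sub>F T0 in sequentially. T0 + 1 \<le> t T0 \<and> t T0 \<le> T T0"
    \<comment> \<open>The maximal inequality starts at time \<open>K+1\<close>, whereas the chosen
      time is at least \<open>T0 + 1\<close>; the latter suffices once \<open>T0\<close> has reached
      \<open>K\<close>.\<close>
    then have t: "\<forall>\<^sub>F T0 in sequentially. t T0 \<in> {K+1..T T0}"
      using eventually_ge_at_top[of K] by eventually_elim auto
    show "smallo_P M (\<lambda>T0 \<omega>. P_hat T0 (t T0) \<omega> - P (t T0) \<omega>) (\<lambda>_. 1)"
    proof (rule smallo_P_AE_dominated[OF finite_measure_axioms _ Z])
      show "\<forall>\<^sub>F T0 in sequentially. (\<lambda>\<omega>. P_hat T0 (t T0) \<omega> - P (t T0) \<omega>) \<in> borel_measurable M"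
        using t by (rule eventually_mono) (rule diff_rv)
      show "\<forall>\<^sub>F T0 in sequentially. AE \<omega> in M. \<bar>P_hat T0 (t T0) \<omega> - P (t T0) \<omega>\<bar> \<le> \<bar>Z T0 \<omega>\<bar>"
        using t
      proof (rule eventually_mono)
        fix T0 assume "t T0 \<in> {K+1..T T0}"
        with bound[of T0] show "AE \<omega> in M. \<bar>P_hat T0 (t T0) \<omega> - P (t T0) \<omega>\<bar> \<le> \<bar>Z T0 \<omega>\<bar>"
          by (auto elim!: AE_mp)
      qed
    qed
  next
    have Z2: "smallo_P M (\<lambda>T0 \<omega>. (Z T0 \<omega>)\<^sup>2) (\<lambda>_. 1)"
      using smallo_P_power2[OF Z] by simp
    show "smallo_P M (\<lambda>T0 \<omega>. (1 / real (T T0)) * (\<Sum>t=K+1..T T0. (P_hat T0 t \<omega> - P t \<omega>)\<^sup>2)) (\<lambda>_. 1)"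
    proof (rule smallo_P_AE_dominated[OF finite_measure_axioms _ Z2]; rule always_eventually, rule allI)
      fix T0
      show "(\<lambda>\<omega>. (1 / real (T T0)) * (\<Sum>t=K+1..T T0. (P_hat T0 t \<omega> - P t \<omega>)\<^sup>2)) \<in> borel_measurable M"
        by (intro borel_measurable_times borel_measurable_const borel_measurable_sum
            borel_measurable_power diff_rv)
      show "AE \<omega> in M. \<bar>(1 / real (T T0)) * (\<Sum>t=K+1..T T0. (P_hat T0 t \<omega> - P t \<omega>)\<^sup>2)\<bar> \<le> \<bar>(Z T0 \<omega>)\<^sup>2\<bar>"
        using bound[of T0]
      proof (rule AE_mp, intro AE_I2 impI)
        fix \<omega> assume "\<forall>t\<in>{K+1..T T0}. \<bar>P_hat T0 t \<omega> - P t \<omega>\<bar> \<le> \<bar>Z T0 \<omega>\<bar>"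
        then have "(1 / real (T T0)) * (\<Sum>t=K+1..T T0. (P_hat T0 t \<omega> - P t \<omega>)\<^sup>2) \<le> (Z T0 \<omega>)\<^sup>2"
          by (intro mean_power2_le) blast
        \<comment> \<open>Nonnegativity of the average removes the absolute value required by the
          domination lemma.\<close>
        moreover have "0 \<le> (1 / real (T T0)) * (\<Sum>t=K+1..T T0. (P_hat T0 t \<omega> - P t \<omega>)\<^sup>2)"
          by (intro mult_nonneg_nonneg sum_nonneg) auto
        ultimately show "\<bar>(1 / real (T T0)) * (\<Sum>t=K+1..T T0. (P_hat T0 t \<omega> - P t \<omega>)\<^sup>2)\<bar> \<le> \<bar>(Z T0 \<omega>)\<^sup>2\<bar>"
          by linarith
      qed
    qed
  qed
qed

end
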